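(* Let $G=(V,E)$ be a finite, simple, connected undirected graph with an MCS ordering $\alpha$. Run the following Recursive Decomposition Algorithm (RDA): set $\mathcal U=\emptyset$ and $W=V$; repeat: let $v$ be the vertex of $W$ with smallest $\alpha(v)$; let $H$ be the convex hull of $N_{G_W}[v]$ in $G_W$; replace $W$ by $N_{G_W}[W\setminus H]$ (computed in $G_W$; this is $\emptyset$ if $H=W$); if $H\not\subseteq U$ for every $U\in\mathcal U$, add $H$ to $\mathcal U$; until $W=\emptyset$. Then the output $\mathcal U$ is precisely the set of (vertex sets of) all atoms of $G$.
   Context: $N_G(x)$ is the neighbourhood of $x$, $N_G[x]=N_G(x)\cup\{x\}$; for $A\subseteq V$, $N_G(A)=\bigcup_{w\in A}N_G(w)\setminus A$, $N_G[A]=N_G(A)\cup A$; $G_A$ is the induced subgraph on $A$. MCS ordering: Maximum Cardinality Search numbers the vertices $n,n-1,\dots,1$ ($n=|V|$); all weights start at $0$; at each step an unnumbered vertex of maximum current weight is chosen (ties arbitrary) and receives the next number, then each of its unnumbered neighbours has its weight increased by $1$; the resulting bijection $\alpha:V\to\{1,\dots,n\}$ is an MCS ordering. A subgraph $G_A$ is convex in a graph $G$ if for every pair of non-adjacent $x,y\in A$ there is no $x$–$y$ path in $G$ with all internal vertices outside $A$; the convex hull of $R$ is the unique inclusion-minimal $H\supseteq R$ with $G_H$ convex. A clique minimal separator of a graph is a set $S$ of pairwise adjacent vertices which, for some vertices $x,y$, meets every $x$–$y$ path while no proper subset of $S$ does. An atom of $G$ is an inclusion-maximal vertex set $A$ such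 that $G_A$ is connected and has no clique minimal separator (as a graph in its own right). *)

theory Defs
  imports
    "Graph_Theory.Digraph_Component_Vwalk"
    "HOL-Library.While_Combinator"
begin

text \<open>
  A finite simple undirected graph is a symmetric, loop-free digraph without
  parallel arcs (locale \<^locale>\<open>graph\<close>); adjacency of \<open>x\<close> and \<open>y\<close> is \<open>x \<rightarrow>\<^bsub>G\<^esub> y\<close>,
  and the induced subgraph on \<open>A\<close> is \<open>G \<restriction> A\<close>. \<^const>\<open>connected\<close> entails that there
  is at least one vertex.
\<close>

definition nbh :: "('a,'b) pre_digraph \<Rightarrow> 'a \<Rightarrow> 'a set" where
  "nbh G x = {y. x \<rightarrow>\<^bsub>G\<^esub> y}"

definition closed_nbh :: "('a,'b) pre_digraph \<Rightarrow> 'a \<Rightarrow> 'a set" where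
  "closed_nbh G x = nbh G x \<union> {x}"

definition set_nbh :: "('a,'b) pre_digraph \<Rightarrow> 'a set \<Rightarrow> 'a set" where
  "set_nbh G A = (\<Union>w\<in>A. nbh G w) - A"

definition closed_set_nbh :: "('a,'b) pre_digraph \<Rightarrow> 'a set \<Rightarrow> 'a set" where
  "closed_set_nbh G A = set_nbh G A \<union> A"

definition path_betw :: "('a,'b) pre_digraph \<Rightarrow> 'a \<Rightarrow> 'a vwalk \<Rightarrow> 'a \<Rightarrow> bool" where
  "path_betw G x p y \<longleftrightarrow> vpath p G \<and> hd p = x \<and> last p = y"

text \<open>
  Maximum Cardinality Search. In \<open>mcs_state G i num wt\<close> the vertices in \<open>dom num\<close> have
  been numbered, \<open>wt\<close> holds the current weights, and \<open>i\<close> is the next number to be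
  assigned; the search is over at \<open>i = 0\<close>.
\<close>

inductive mcs_state ::
  "('a,'b) pre_digraph \<Rightarrow> nat \<Rightarrow> ('a \<rightharpoonup> nat) \<Rightarrow> ('a \<Rightarrow> nat) \<Rightarrow> bool"
  for G where
  init: "mcs_state G (card (verts G)) Map.empty (\<lambda>_. 0)"
| step: "\<lbrakk> mcs_state G (Suc i) num wt;
           x \<in> verts G - dom num;
           \<forall>y \<in> verts G - dom num. wt y \<le> wt x \<rbrakk>
         \<Longrightarrow> mcs_state G i (num(x \<mapsto> Suc i))
               (\<lambda>y. if y \<in> nbh G x - dom num then wt y + 1 else wt y)"

definition mcs_ordering :: "('a,'b) pre_digraph \<Rightarrow> ('a \<Rightarrow> nat) \<Rightarrow> bool" where
  "mcs_ordering G \<alpha> \<longleftrightarrow>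
     (\<exists>num wt. mcs_state G 0 num wt \<and> (\<forall>x \<in> verts G. num x = Some (\<alpha> x)))"

definition convex_in :: "('a,'b) pre_digraph \<Rightarrow> 'a set \<Rightarrow> bool" where
  "convex_in G A \<longleftrightarrow> A \<subseteq> verts G \<and>
     (\<forall>x \<in> A. \<forall>y \<in> A. x \<noteq> y \<and> \<not> (x \<rightarrow>\<^bsub>G\<^esub> y) \<longrightarrow>
        \<not> (\<exists>p. path_betw G x p y \<and> (set p - {x, y}) \<inter> A = {}))"

text \<open>
  Convex sets of a graph are closed under intersection (a path between two vertices of a
  convex set \<open>A\<close> can be shortcut to one inside \<open>A\<close> using only vertices of the given path),
  so the description below is satisfied by exactly one set whenever \<open>R \<subseteq> verts G\<close> and
  \<open>G\<close> is finite.
\<close>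

definition conv_hull :: "('a,'b) pre_digraph \<Rightarrow> 'a set \<Rightarrow> 'a set" where
  "conv_hull G R = (THE H. R \<subseteq> H \<and> convex_in G H \<and>
     (\<forall>H'. R \<subseteq> H' \<and> convex_in G H' \<and> H' \<subseteq> H \<longrightarrow> H' = H))"

definition meets_all_paths ::
  "('a,'b) pre_digraph \<Rightarrow> 'a \<Rightarrow> 'a \<Rightarrow> 'a set \<Rightarrow> bool" where
  "meets_all_paths G x y S \<longleftrightarrow> (\<forall>p. path_betw G x p y \<longrightarrow> set p \<inter> S \<noteq> {})"

text \<open>
  The separated vertices lie outside the separator; otherwise every singleton \<open>{x}\<close> would
  be a clique minimal separator.
\<close>

definition clique_min_separator :: "('a,'b) pre_digraph \<Rightarrow> 'a set \<Rightarrow> bool" where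
  "clique_min_separator G S \<longleftrightarrow> S \<subseteq> verts G \<and>
     (\<forall>u \<in> S. \<forall>w \<in> S. u \<noteq> w \<longrightarrow> u \<rightarrow>\<^bsub>G\<^esub> w) \<and>
     (\<exists>x \<in> verts G - S. \<exists>y \<in> verts G - S.
        meets_all_paths G x y S \<and> (\<forall>T. T \<subset> S \<longrightarrow> \<not> meets_all_paths G x y T))"

definition conn_no_clique_sep :: "('a,'b) pre_digraph \<Rightarrow> 'a set \<Rightarrow> bool" where
  "conn_no_clique_sep G A \<longleftrightarrow> A \<subseteq> verts G \<and> connected (G \<restriction> A) \<and>
     \<not> (\<exists>S. clique_min_separator (G \<restriction> A) S)"

definition atom :: "('a,'b) pre_digraph \<Rightarrow> 'a set \<Rightarrow> bool" where
  "atom G A \<longleftrightarrow> conn_no_clique_sep G A \<and>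
     (\<forall>B. conn_no_clique_sep G B \<and> A \<subseteq> B \<longrightarrow> B = A)"

definition rda_step ::
  "('a,'b) pre_digraph \<Rightarrow> ('a \<Rightarrow> nat) \<Rightarrow> 'a set set \<times> 'a set \<Rightarrow> 'a set set \<times> 'a set" where
  "rda_step G \<alpha> = (\<lambda>(\<U>, W).
     let v = arg_min_on \<alpha> W;
         H = conv_hull (G \<restriction> W) (closed_nbh (G \<restriction> W) v)
     in (if \<forall>U \<in> \<U>. \<not> H \<subseteq> U then insert H \<U> else \<U>,
         closed_set_nbh (G \<restriction> W) (W - H)))"

text \<open>
  The body is executed once before the first test, as in a repeat-until loop. The result is
  \<^const>\<open>None\<close> if the loop does not terminate.
\<close>

definition rda :: "('a,'b) pre_digraph \<Rightarrow> ('a \<Rightarrow> nat) \<Rightarrow> 'a set set option" where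
  "rda G \<alpha> = map_option fst
     (while_option (\<lambda>(\<U>, W). W \<noteq> {}) (rda_step G \<alpha>) (rda_step G \<alpha> ({}, verts G)))"

end

theory Submission
  imports Defs
begin

text \<open>
  Call a set unsplittable if it is not covered by two sides without edges between them that
  meet in a (possibly empty) clique \<open>S\<close>; atoms are the maximal unsplittable sets.

  The key property of a maximum cardinality search is that, when a clique \<open>S\<close> splits \<open>G\<close> and
  \<open>v \<in> S\<close>, the neighbours of \<open>v\<close> numbered before \<open>v\<close> avoid one of the two sides. If this holds
  in \<open>G \<restriction> W\<close> for the last numbered vertex \<open>v\<close> of \<open>W\<close>, then the hull \<open>H\<close> of its closed
  neighbourhood is unsplittable: by convexity a split of \<open>H\<close> extends to a split of \<open>W\<close>,
  one side of which is convex and contains the closed neighbourhood, hence \<open>H\<close>.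

  Passing from \<open>W\<close> to the closed neighbourhood of \<open>W - H\<close> may destroy this property at a
  vertex \<open>w\<close>, because two earlier neighbours of \<open>w\<close> in \<open>H\<close> may have been joined through
  deleted vertices of \<open>H\<close> only. But then all earlier neighbours of \<open>w\<close> that are left lie in \<open>H\<close>,
  so that a hull computed at \<open>w\<close> later on is contained in \<open>H\<close> and is discarded.
\<close>

section \<open>Reachability, clique splits and convexity as predicates on vertex sets\<close>

context graph
begin

text \<open>The closure is reflexive at every vertex, even outside \<open>Z\<close>, so membership
  of an endpoint in \<open>Z\<close> has to be stated separately when an actual walk is
  meant.\<close>

definition reach_in :: "'a set \<Rightarrow> 'a \<Rightarrow> 'a \<Rightarrow> bool" where
  "reach_in Z = (\<lambda>x y. x \<rightarrow> y \<and> x \<in> Z \<and> y \<in> Z)\<^sup>*\<^sup>*"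

definition clique :: "'a set \<Rightarrow> bool" where
  "clique S \<longleftrightarrow> (\<forall>u\<in>S. \<forall>w\<in>S. u \<noteq> w \<longrightarrow> u \<rightarrow> w)"

text \<open>Empty parts are allowed, which keeps the notion stable under restriction to subsets;
  \<open>S = {}\<close> with two non-empty sides expresses disconnectedness.\<close>

definition clique_split :: "'a set \<Rightarrow> 'a set \<Rightarrow> 'a set \<Rightarrow> 'a set \<Rightarrow> bool" where
  "clique_split W S A B \<longleftrightarrow> W = S \<union> A \<union> B \<and> S \<inter> A = {} \<and> S \<inter> B = {} \<and> A \<inter> B = {} \<and>
     clique S \<and> (\<forall>a\<in>A. \<forall>b\<in>B. \<not> a \<rightarrow> b)"

definition convex_set :: "'a set \<Rightarrow> 'a set \<Rightarrow> bool" where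
  "convex_set W H \<longleftrightarrow> H \<subseteq> W \<and>
     (\<forall>x\<in>H. \<forall>y\<in>H. reach_in ((W - H) \<union> {x, y}) x y \<longrightarrow> x = y \<or> x \<rightarrow> y)"

definition unsplittable :: "'a set \<Rightarrow> bool" where
  "unsplittable H \<longleftrightarrow> H \<noteq> {} \<and> \<not> (\<exists>S A B. clique_split H S A B \<and> A \<noteq> {} \<and> B \<noteq> {})"

lemma dominates_sym: "x \<rightarrow> y \<longleftrightarrow> y \<rightarrow> x"
  using sym_arcs by (auto simp: symmetric_def sym_def)

lemma dominates_irrefl: "\<not> x \<rightarrow> x"
  using adj_not_same by blast

lemma clique_split_commute: "clique_split W S A B \<Longrightarrow> clique_split W S B A"
  unfolding clique_split_def by (metis Int_commute dominates_sym sup_assoc sup_commute)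

subsection \<open>Walks and convex sets\<close>

lemma reach_in_refl: "reach_in Z x x"
  by (simp add: reach_in_def)

lemma reach_in_trans: "reach_in Z x y \<Longrightarrow> reach_in Z y z \<Longrightarrow> reach_in Z x z"
  unfolding reach_in_def by (rule rtranclp_trans)

lemma reach_in_edge: "x \<rightarrow> y \<Longrightarrow> x \<in> Z \<Longrightarrow> y \<in> Z \<Longrightarrow> reach_in Z x y"
  unfolding reach_in_def by auto

lemma reach_in_mono: "reach_in Z x y \<Longrightarrow> Z \<subseteq> Z' \<Longrightarrow> reach_in Z' x y"
  unfolding reach_in_def by (erule rtranclp_mono[THEN predicate2D, rotated]) auto

lemma reach_in_sym: "reach_in Z x y \<Longrightarrow> reach_in Z y x"
  unfolding reach_in_def
  by (rule sympD[OF symp_rtranclp]) (auto intro: sympI simp: dominates_sym)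

lemma reach_in_mem: "reach_in Z x y \<Longrightarrow> x \<in> Z \<longleftrightarrow> y \<in> Z"
  unfolding reach_in_def by (induct rule: rtranclp_induct) auto

lemma reach_in_closed:
  assumes "reach_in Z x y" and "x \<in> Q" and "\<And>u w. u \<in> Q \<Longrightarrow> u \<in> Z \<Longrightarrow> w \<in> Z \<Longrightarrow> u \<rightarrow> w \<Longrightarrow> w \<in> Q"
  shows "y \<in> Q"
  using assms(1,2) unfolding reach_in_def
  by (induct rule: rtranclp_induct) (auto intro: assms(3))

text \<open>An excursion outside \<open>H\<close> leaves and re-enters \<open>H\<close> at vertices
  that convexity makes equal or adjacent, so at most one edge replaces it.\<close>

lemma reach_in_shortcut:
  assumes H: "convex_set W H" and Z: "Z \<subseteq> W" and "reach_in Z x y" and "x \<in> H" and "y \<in> H"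
  shows "reach_in (Z \<inter> H) x y"
proof -
  \<comment> \<open>\<open>h\<close> is the last vertex of \<open>H\<close> met so far: the walk up
    to \<open>h\<close> is already shortcut, and the current excursion runs from \<open>h\<close>
    through \<open>Z - H\<close>.\<close>
  have "\<exists>h\<in>H. reach_in (Z \<inter> H) x h \<and> reach_in ((Z - H) \<union> {h}) h y"
    using assms(3,4) unfolding reach_in_def[of Z]
  proof (induct rule: rtranclp_induct)
    case base
    then show ?case by (auto intro: reach_in_refl)
  next
    case (step y z)
    then obtain h where h: "h \<in> H" "reach_in (Z \<inter> H) x h" "reach_in ((Z - H) \<union> {h}) h y"
      by auto
    have yz: "y \<rightarrow> z" "y \<in> Z" "z \<in> Z" using step by auto
    have y: "y \<in> (Z - H) \<union> {h}" using reach_in_mem[OF h(3)] by simp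
    show ?case
    proof (cases "z \<in> H")
      case True
      have "reach_in ((W - H) \<union> {h, z}) h y"
        by (rule reach_in_mono[OF h(3)]) (use Z in auto)
      moreover have "reach_in ((W - H) \<union> {h, z}) y z"
        by (rule reach_in_edge) (use yz y Z in auto)
      ultimately have "h = z \<or> h \<rightarrow> z"
        using H h(1) True reach_in_trans unfolding convex_set_def by blast
      moreover have "h \<in> Z \<or> h = x" using reach_in_mem[OF h(2)] h(2)
        unfolding reach_in_def by (metis (no_types, lifting) IntD1 rtranclp.cases)
      moreover have "x \<in> Z" 
        using step(1) yz(2) reach_in_mem[of Z x y] unfolding reach_in_def by simp
      ultimately have "reach_in (Z \<inter> H) x z"
        using h True yz reach_in_edge[of h z "Z \<inter> H"] reach_in_trans by auto
      then show ?thesis using True reach_in_refl by blast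
    next
      case False
      have "reach_in ((Z - H) \<union> {h}) y z"
        by (rule reach_in_edge) (use yz y False in auto)
      then show ?thesis using h reach_in_trans by blast
    qed
  qed
  then obtain h where h: "h \<in> H" "reach_in (Z \<inter> H) x h" "reach_in ((Z - H) \<union> {h}) h y" by auto
  have "y \<in> (Z - H) \<union> {h}" using reach_in_mem[OF h(3)] by simp
  then show ?thesis using h assms(5) by auto
qed

lemma reach_in_pair: "reach_in {x, y} x y \<Longrightarrow> x = y \<or> x \<rightarrow> y"
  using reach_in_closed[of "{x, y}" x y "{x} \<union> {z. z = y \<and> x \<rightarrow> y}"] by auto

text \<open>Shortcutting a walk first into \<open>H\<close> and then into \<open>H'\<close> leaves a
  walk on \<open>x\<close> and \<open>y\<close> alone.\<close>

lemma convex_set_Int: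
  assumes "convex_set W H" and "convex_set W H'"
  shows "convex_set W (H \<inter> H')"
  unfolding convex_set_def
proof (intro conjI ballI impI)
  show "H \<inter> H' \<subseteq> W" using assms unfolding convex_set_def by auto
  fix x y assume x: "x \<in> H \<inter> H'" and y: "y \<in> H \<inter> H'"
    and r: "reach_in (W - H \<inter> H' \<union> {x, y}) x y"
  let ?Z = "W - H \<inter> H' \<union> {x, y}"
  have Z: "?Z \<subseteq> W" using x y assms unfolding convex_set_def by auto
  have "reach_in (?Z \<inter> H) x y" using reach_in_shortcut[OF assms(1) Z r] x y by auto
  then have "reach_in (?Z \<inter> H \<inter> H') x y"
    using reach_in_shortcut[OF assms(2), of "?Z \<inter> H"] x y Z by auto
  moreover have "?Z \<inter> H \<inter> H' = {x, y}" using x y by auto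
  ultimately show "x = y \<or> x \<rightarrow> y" using reach_in_pair by simp
qed

lemma convex_set_self: "convex_set W W"
  unfolding convex_set_def using reach_in_pair by auto

lemma convex_set_restrict:
  assumes "convex_set W H" and "W' \<subseteq> W"
  shows "convex_set W' (H \<inter> W')"
  unfolding convex_set_def
proof (intro conjI ballI impI)
  fix x y assume x: "x \<in> H \<inter> W'" and y: "y \<in> H \<inter> W'"
    and r: "reach_in (W' - H \<inter> W' \<union> {x, y}) x y"
  have "reach_in (W - H \<union> {x, y}) x y"
    by (rule reach_in_mono[OF r]) (use assms(2) in auto)
  then show "x = y \<or> x \<rightarrow> y" using assms x y unfolding convex_set_def by auto
qed auto

text \<open>Any excursion from \<open>S \<union> A\<close> runs through \<open>B\<close>, and within
  \<open>S \<union> A\<close> only vertices of the clique \<open>S\<close> can have neighbours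
  there.\<close>

lemma convex_set_split_side:
  assumes "clique_split W S A B"
  shows "convex_set W (S \<union> A)"
  unfolding convex_set_def
proof (intro conjI ballI impI)
  show "S \<union> A \<subseteq> W" using assms unfolding clique_split_def by auto
  fix x y assume x: "x \<in> S \<union> A" and y: "y \<in> S \<union> A"
    and r: "reach_in (W - (S \<union> A) \<union> {x, y}) x y"
  have Z: "W - (S \<union> A) \<union> {x, y} = B \<union> {x, y}"
    using assms unfolding clique_split_def by auto
  have r: "reach_in (B \<union> {x, y}) x y" using r Z by simp
  show "x = y \<or> x \<rightarrow> y"
  proof (cases "x \<in> S \<and> y \<in> S")
    case True
    then show ?thesis using assms unfolding clique_split_def clique_def by auto
  next
    case False
    have sep: "\<not> a \<rightarrow> b" "\<not> b \<rightarrow> a" if "a \<in> A" "b \<in> B" for a b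
      using assms that dominates_sym unfolding clique_split_def by blast+
    \<comment> \<open>The first edge of a walk leaving \<open>p\<close> can enter neither
      \<open>B\<close> nor \<open>p\<close> itself, so it goes directly to \<open>q\<close>.\<close>
    have step: "p = q \<or> p \<rightarrow> q" if "p \<in> A" "reach_in (B \<union> {p, q}) p q" for p q
      using that(2) unfolding reach_in_def
    proof (cases rule: converse_rtranclpE)
      case (step z)
      then show ?thesis using sep[OF that(1)] dominates_irrefl by auto
    qed simp
    consider "x \<in> A" | "y \<in> A" using False x y by auto
    then show ?thesis
    proof cases
      case 1
      then show ?thesis using step r by blast
    next
      case 2
      then show ?thesis
        using step[of y x] reach_in_sym[OF r] dominates_sym by (metis insert_commute)
    qed
  qed
qed

text \<open>\<open>K\<close> is the component of \<open>c\<close> in \<open>W - H\<close> and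
  \<open>T\<close> its attachment in \<open>H\<close>. Two vertices of \<open>T\<close> are joined
  through \<open>K\<close>, so convexity makes \<open>T\<close> a clique. The last conclusion serves
  to place \<open>T\<close> in the next working set.\<close>

lemma convex_set_component:
  assumes H: "convex_set W H" and c: "c \<in> W - H"
  obtains K T where "c \<in> K" "K \<subseteq> W - H" "T \<subseteq> H" "clique_split W T K (W - K - T)"
    "\<And>t. t \<in> T \<Longrightarrow> \<exists>k\<in>K. k \<rightarrow> t"
proof -
  define K where "K = {k. reach_in (W - H) c k}"
  define T where "T = {h \<in> H. \<exists>k\<in>K. k \<rightarrow> h}"
  have K: "K \<subseteq> W - H" using reach_in_mem c unfolding K_def by blast
  have HW: "H \<subseteq> W" using H unfolding convex_set_def by auto
  have "clique T" unfolding clique_def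
  proof (intro ballI impI)
    fix u w assume u: "u \<in> T" and w: "w \<in> T" and "u \<noteq> w"
    obtain k l where k: "k \<in> K" "k \<rightarrow> u" and l: "l \<in> K" "l \<rightarrow> w"
      using u w unfolding T_def by auto
    let ?Z = "(W - H) \<union> {u, w}"
    have "reach_in (W - H) k l"
      using k l reach_in_trans reach_in_sym unfolding K_def by blast
    then have "reach_in ?Z k l" by (rule reach_in_mono) auto
    moreover have "reach_in ?Z u k" by (rule reach_in_edge) (use k K dominates_sym in auto)
    moreover have "reach_in ?Z l w" by (rule reach_in_edge) (use l K in auto)
    ultimately have "reach_in ?Z u w" using reach_in_trans by blast
    then show "u \<rightarrow> w" using H u w \<open>u \<noteq> w\<close> unfolding convex_set_def T_def by auto
  qed
  moreover have "y \<in> K \<union> T" if "k \<in> K" "y \<in> W" "k \<rightarrow> y" for k y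
  proof (cases "y \<in> H")
    case True
    then show ?thesis using that unfolding T_def by auto
  next
    case False
    then have "reach_in (W - H) k y" using that K by (auto intro: reach_in_edge)
    then show ?thesis using that(1) reach_in_trans unfolding K_def by blast
  qed
  ultimately have "clique_split W T K (W - K - T)"
    using K HW unfolding clique_split_def T_def by blast
  moreover have "c \<in> K" unfolding K_def by (simp add: reach_in_refl)
  moreover have "T \<subseteq> H" and "\<And>t. t \<in> T \<Longrightarrow> \<exists>k\<in>K. k \<rightarrow> t" unfolding T_def by auto
  ultimately show ?thesis using that K by blast
qed

text \<open>Components of \<open>W - H\<close> that touch \<open>A\<close> join \<open>A\<close>,
  all others join \<open>B\<close>. A component touching both would give an excursion between
  non-adjacent vertices of \<open>H\<close>.\<close>

lemma clique_split_extend: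
  assumes H: "convex_set W H" and s: "clique_split H S A B"
  obtains A' B' where "clique_split W S A' B'" "A \<subseteq> A'" "B \<subseteq> B'"
proof -
  define A' where "A' = A \<union> {k \<in> W - H. \<exists>l a. reach_in (W - H) k l \<and> l \<in> W - H \<and> a \<in> A \<and> l \<rightarrow> a}"
  define B' where "B' = W - S - A'"
  have HW: "H \<subseteq> W" using H unfolding convex_set_def by auto
  have Hs: "H = S \<union> A \<union> B" "S \<inter> A = {}" "S \<inter> B = {}" "A \<inter> B = {}" "clique S"
    and sep: "\<And>a b. a \<in> A \<Longrightarrow> b \<in> B \<Longrightarrow> \<not> a \<rightarrow> b"
    using s unfolding clique_split_def by auto
  have "\<not> x \<rightarrow> y" if x: "x \<in> A'" and y: "y \<in> B'" for x y
  proof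
    assume e: "x \<rightarrow> y"
    show False
    proof (cases "x \<in> A")
      case True
      then have "y \<notin> B" using sep e by auto
      then have "y \<in> W - H" using y Hs unfolding B'_def A'_def by auto
      then have "y \<in> A'" using True e reach_in_refl dominates_sym unfolding A'_def by blast
      then show False using y unfolding B'_def by auto
    next
      case False
      then obtain l a where l: "x \<in> W - H" "reach_in (W - H) x l" "l \<in> W - H" "a \<in> A" "l \<rightarrow> a"
        using x unfolding A'_def by auto
      show False
      proof (cases "y \<in> H")
        case True
        then have yB: "y \<in> B" using y Hs unfolding B'_def A'_def by auto
        let ?Z = "(W - H) \<union> {a, y}"
        have "reach_in ?Z l x" using reach_in_sym[OF l(2)] by (rule reach_in_mono) auto
        moreover have "reach_in ?Z a l" by (rule reach_in_edge) (use l dominates_sym in auto)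
        moreover have "reach_in ?Z x y" by (rule reach_in_edge) (use l e in auto)
        ultimately have "reach_in ?Z a y" using reach_in_trans by blast
        then have "a = y \<or> a \<rightarrow> y" using H l(4) True Hs unfolding convex_set_def by blast
        then show False using sep[OF l(4) yB] Hs l(4) yB by auto
      next
        case False
        then have yW: "y \<in> W - H" using y unfolding B'_def by auto
        have "reach_in (W - H) y x" by (rule reach_in_edge) (use yW l e dominates_sym in auto)
        then have "y \<in> A'" using yW l reach_in_trans unfolding A'_def by blast
        then show False using y unfolding B'_def by auto
      qed
    qed
  qed
  then have "clique_split W S A' B'"
    using Hs HW unfolding clique_split_def B'_def A'_def by blast
  moreover have "A \<subseteq> A'" "B \<subseteq> B'" using Hs HW unfolding B'_def A'_def by auto
  ultimately show ?thesis using that by blast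
qed

subsection \<open>Correspondence with the path-based notions\<close>

lemma dominates_induce: "x \<rightarrow>\<^bsub>G \<restriction> W\<^esub> y \<longleftrightarrow> x \<rightarrow> y \<and> x \<in> W \<and> y \<in> W"
  by (auto simp: arcs_ends_def arc_to_ends_def)

text \<open>Loop erasure turns a walk into a path on a subset of its vertices. The parameter
  \<open>Z\<close> lets one statement serve both convexity (\<open>- H \<union> {x, y}\<close>) and
  separation (\<open>- S\<close>).\<close>

lemma ex_path_betw_iff:
  "(\<exists>p. path_betw (G \<restriction> W) x p y \<and> set p \<subseteq> Z) \<longleftrightarrow> x \<in> W \<inter> Z \<and> reach_in (W \<inter> Z) x y"
proof
  assume "\<exists>p. path_betw (G \<restriction> W) x p y \<and> set p \<subseteq> Z"
  then obtain p where p: "vwalk p (G \<restriction> W)" "hd p = x" "last p = y" "set p \<subseteq> Z"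
    unfolding path_betw_def by auto
  have "hd p \<in> W \<inter> Z" using p by (cases p) (auto simp: vwalk_def)
  moreover have "reach_in (W \<inter> Z) (hd p) (last p)" using p(1,4)
  proof (induct rule: vwalk_induct)
    case (Base u)
    then show ?case by (simp add: reach_in_refl)
  next
    case (Cons u v es)
    then have "reach_in (W \<inter> Z) u v" using dominates_induce by (auto intro: reach_in_edge)
    then show ?case using Cons reach_in_trans[of "W \<inter> Z" u v] by auto
  qed
  ultimately show "x \<in> W \<inter> Z \<and> reach_in (W \<inter> Z) x y" using p by simp
next
  assume r: "x \<in> W \<inter> Z \<and> reach_in (W \<inter> Z) x y"
  then have "reach_in (W \<inter> Z) x y" "y \<in> W \<inter> Z" using reach_in_mem by blast+
  then have "\<exists>p. vwalk p (G \<restriction> W) \<and> hd p = x \<and> last p = y \<and> set p \<subseteq> Z"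
    unfolding reach_in_def
  proof (induct rule: converse_rtranclp_induct)
    case base
    then show ?case by (intro exI[of _ "[y]"]) (auto simp: vwalk_def)
  next
    case (step u v)
    then obtain p where p: "vwalk p (G \<restriction> W)" "hd p = v" "last p = y" "set p \<subseteq> Z" by auto
    have "vwalk (u # p) (G \<restriction> W)"
      by (rule vwalk_consI) (use p step dominates_induce in auto)
    moreover have "p \<noteq> []" using p by (auto simp: vwalk_def)
    ultimately show ?case using p step by (intro exI[of _ "u # p"]) auto
  qed
  then obtain p where p: "vwalk p (G \<restriction> W)" "hd p = x" "last p = y" "set p \<subseteq> Z" by auto
  have "path_betw (G \<restriction> W) x (vwalk_to_vpath p) y"
    unfolding path_betw_def using p(2,3) vwalk_to_vpath_vpath[OF p(1)]
    by (simp add: vwalk_to_vpath_hd vwalk_to_vpath_last)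
  moreover have "set (vwalk_to_vpath p) \<subseteq> Z" 
    using p(4) vwalk_to_vpath_subset[of _ p] by auto
  ultimately show "\<exists>p. path_betw (G \<restriction> W) x p y \<and> set p \<subseteq> Z" by blast
qed

lemma convex_in_induce: "convex_in (G \<restriction> W) H \<longleftrightarrow> convex_set W H"
proof (cases "H \<subseteq> W")
  case True
  have "(\<exists>p. path_betw (G \<restriction> W) x p y \<and> (set p - {x, y}) \<inter> H = {}) \<longleftrightarrow>
      reach_in ((W - H) \<union> {x, y}) x y" if "x \<in> H" "y \<in> H" for x y
  proof -
    have "(set p - {x, y}) \<inter> H = {} \<longleftrightarrow> set p \<subseteq> - H \<union> {x, y}" for p by auto
    moreover have "W \<inter> (- H \<union> {x, y}) = (W - H) \<union> {x, y}" using True that by auto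
    ultimately show ?thesis using ex_path_betw_iff[of W x y "- H \<union> {x, y}"] by auto
  qed
  moreover have "x \<rightarrow>\<^bsub>G \<restriction> W\<^esub> y \<longleftrightarrow> x \<rightarrow> y" if "x \<in> H" "y \<in> H" for x y
    using True that by (auto simp: dominates_induce)
  ultimately show ?thesis using True
    unfolding convex_in_def convex_set_def induce_subgraph_verts by (smt (verit) ball_cong)
qed (auto simp: convex_in_def convex_set_def)

lemma meets_all_paths_induce:
  assumes "x \<in> W - S"
  shows "meets_all_paths (G \<restriction> W) x y S \<longleftrightarrow> \<not> reach_in (W - S) x y"
proof -
  have "set p \<inter> S = {} \<longleftrightarrow> set p \<subseteq> - S" for p by auto
  moreover have "W \<inter> - S = W - S" by auto
  ultimately show ?thesis
    using ex_path_betw_iff[of W x y "- S"] assms unfolding meets_all_paths_def by auto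
qed

lemma connected_induce:
  "connected (G \<restriction> A) \<longleftrightarrow> A \<noteq> {} \<and> (\<forall>u\<in>A. \<forall>v\<in>A. reach_in A u v)"
proof -
  have "(u, v) \<in> rtrancl_on A ((arcs_ends (G \<restriction> A))\<^sup>s) \<longleftrightarrow> reach_in A u v" if "u \<in> A" for u v
  proof
    assume "(u, v) \<in> rtrancl_on A ((arcs_ends (G \<restriction> A))\<^sup>s)"
    then show "reach_in A u v"
    proof (induct rule: rtrancl_on_induct)
      case (step y z)
      then have "reach_in A y z"
        using dominates_induce dominates_sym by (auto simp: symcl_def intro!: reach_in_edge)
      then show ?case using step reach_in_trans by blast
    qed (simp add: reach_in_refl)
  next
    assume "reach_in A u v"
    then show "(u, v) \<in> rtrancl_on A ((arcs_ends (G \<restriction> A))\<^sup>s)"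
      unfolding reach_in_def
    proof (induct rule: rtranclp_induct)
      case (step y z)
      then show ?case
        using dominates_induce by (auto simp: symcl_def intro: rtrancl_on_into_rtrancl_on)
    qed (simp add: that)
  qed
  then show ?thesis unfolding connected_conv by auto
qed

lemma reach_in_split:
  assumes "clique_split W S A B" and "reach_in (W - S) x y" and "x \<in> A"
  shows "y \<in> A"
  by (rule reach_in_closed[OF assms(2,3)]) (use assms(1) in \<open>auto simp: clique_split_def\<close>)

text \<open>A non-trivial split yields a minimal separator by shrinking \<open>S\<close>, which
  keeps it a clique. Conversely, a clique separator yields a split with the component of
  \<open>x\<close> as one side, and \<open>S = {}\<close> accounts for connectedness.\<close>

lemma conn_no_clique_sep_iff:
  "conn_no_clique_sep G A \<longleftrightarrow> A \<subseteq> verts G \<and> unsplittable A"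
proof -
  have splitI: "clique_split A S {z \<in> A. reach_in (A - S) x z} (A - S - {z. reach_in (A - S) x z})"
    if "clique S" "S \<subseteq> A" "x \<in> A - S" for S x
  proof -
    have "z \<notin> S" if "reach_in (A - S) x z" for z
      using reach_in_mem[OF that] \<open>x \<in> A - S\<close> by auto
    moreover have "reach_in (A - S) x w"
      if "reach_in (A - S) x z" "z \<rightarrow> w" "w \<in> A" "w \<notin> S" for z w
    proof -
      have "z \<in> A - S" using reach_in_mem[OF that(1)] \<open>x \<in> A - S\<close> by auto
      then show ?thesis
        using reach_in_trans[OF that(1) reach_in_edge[OF that(2)]] that by auto
    qed
    ultimately show ?thesis using that unfolding clique_split_def by blast
  qed
  show ?thesis
  proof (cases "A \<subseteq> verts G \<and> A \<noteq> {}")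
    case A: True
    show ?thesis
    proof
      assume c: "conn_no_clique_sep G A"
      have False if s: "clique_split A S P Q" and ne: "P \<noteq> {}" "Q \<noteq> {}" for S P Q
      proof -
        obtain x y where xy: "x \<in> P" "y \<in> Q" using ne by auto
        have "S \<subseteq> A" and xyS: "x \<in> A - S" "y \<in> A - S" and "y \<notin> P"
          using s xy unfolding clique_split_def by auto
        then have "\<not> reach_in (A - S) x y" using reach_in_split[OF s] xy by auto
        \<comment> \<open>Minimality among subsets of \<open>S\<close> is enough: every proper
          subset of \<open>T\<close> is one of them.\<close>
        moreover have "finite {T. T \<subseteq> S \<and> \<not> reach_in (A - T) x y}"
          using A \<open>S \<subseteq> A\<close> finite_subset[OF _ finite_verts, of S] by auto
        ultimately obtain T where T: "T \<subseteq> S" "\<not> reach_in (A - T) x y"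
          and min: "\<And>T'. T' \<subseteq> S \<Longrightarrow> \<not> reach_in (A - T') x y \<Longrightarrow> T' \<subseteq> T \<Longrightarrow> T = T'"
          using finite_has_minimal2[of "{T. T \<subseteq> S \<and> \<not> reach_in (A - T) x y}" S] by auto
        have "clique T" using s T(1) unfolding clique_split_def clique_def by blast
        have "meets_all_paths (G \<restriction> A) x y T"
          using meets_all_paths_induce[of x A T y] T xyS by auto
        moreover have "\<not> meets_all_paths (G \<restriction> A) x y T'" if "T' \<subset> T" for T'
          using min[of T'] T xyS meets_all_paths_induce[of x A T' y] that by auto
        moreover have "\<forall>u\<in>T. \<forall>w\<in>T. u \<noteq> w \<longrightarrow> u \<rightarrow>\<^bsub>G \<restriction> A\<^esub> w"
          using \<open>clique T\<close> T(1) \<open>S \<subseteq> A\<close> unfolding clique_def dominates_induce by blast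
        moreover have "T \<subseteq> A" "x \<in> A - T" "y \<in> A - T" using T(1) xyS \<open>S \<subseteq> A\<close> by auto
        ultimately have "clique_min_separator (G \<restriction> A) T"
          unfolding clique_min_separator_def induce_subgraph_verts by blast
        then show False using c unfolding conn_no_clique_sep_def by blast
      qed
      then show "A \<subseteq> verts G \<and> unsplittable A" using A unfolding unsplittable_def by blast
    next
      assume "A \<subseteq> verts G \<and> unsplittable A"
      then have ns: "\<And>S P Q. clique_split A S P Q \<Longrightarrow> P \<noteq> {} \<Longrightarrow> Q \<noteq> {} \<Longrightarrow> False"
        unfolding unsplittable_def by blast
      have reach: "reach_in (A - S) x y"
        if "clique S" "S \<subseteq> A" "x \<in> A - S" "y \<in> A - S" for S x y
      proof (rule ccontr)
        assume "\<not> reach_in (A - S) x y"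
        then show False using ns[OF splitI[OF that(1-3)]] that reach_in_refl by blast
      qed
      have "connected (G \<restriction> A)"
        using reach[of "{}"] A unfolding connected_induce by (auto simp: clique_def)
      moreover have "\<not> clique_min_separator (G \<restriction> A) S" for S
      proof
        assume S: "clique_min_separator (G \<restriction> A) S"
        then obtain x y where "x \<in> A - S" "y \<in> A - S" "meets_all_paths (G \<restriction> A) x y S"
          unfolding clique_min_separator_def by auto
        moreover have "clique S" "S \<subseteq> A"
          using S unfolding clique_min_separator_def clique_def dominates_induce by auto
        ultimately show False using reach meets_all_paths_induce by blast
      qed
      ultimately show "conn_no_clique_sep G A" using A unfolding conn_no_clique_sep_def by blast
    qed
  qed (auto simp: unsplittable_def conn_no_clique_sep_def connected_induce)
qed

lemma atom_iff:
  "atom G A \<longleftrightarrow> A \<subseteq> verts G \<and> unsplittable A \<and>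
     (\<forall>B. B \<subseteq> verts G \<and> unsplittable B \<and> A \<subseteq> B \<longrightarrow> B = A)"
  unfolding atom_def conn_no_clique_sep_iff by auto

lemma unsplittable_subset_atom:
  assumes "A \<subseteq> verts G" and "unsplittable A"
  obtains B where "atom G B" "A \<subseteq> B"
proof -
  have "finite {B. B \<subseteq> verts G \<and> unsplittable B}"
    by (rule finite_subset[of _ "Pow (verts G)"]) auto
  then obtain B where "B \<subseteq> verts G" "unsplittable B" "A \<subseteq> B"
    "\<And>C. C \<subseteq> verts G \<Longrightarrow> unsplittable C \<Longrightarrow> B \<subseteq> C \<Longrightarrow> B = C"
    using finite_has_maximal2[of "{B. B \<subseteq> verts G \<and> unsplittable B}" A] assms by auto
  then have "atom G B" unfolding atom_iff by auto
  with \<open>A \<subseteq> B\<close> show ?thesis using that by blast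
qed

text \<open>Closure under intersection turns an inclusion-minimal convex superset into the least
  one, so the description in \<open>conv_hull\<close> has a unique solution.\<close>

lemma conv_hull_least:
  assumes "W \<subseteq> verts G" and "R \<subseteq> W"
  shows "R \<subseteq> conv_hull (G \<restriction> W) R" and "convex_set W (conv_hull (G \<restriction> W) R)"
    and "\<And>H. R \<subseteq> H \<Longrightarrow> convex_set W H \<Longrightarrow> conv_hull (G \<restriction> W) R \<subseteq> H"
proof -
  let ?F = "{H. R \<subseteq> H \<and> convex_set W H}"
  have "finite W" using finite_subset[OF assms(1) finite_verts] .
  moreover have "?F \<subseteq> Pow W" unfolding convex_set_def by auto
  ultimately have "finite ?F" by (meson finite_Pow_iff finite_subset)
  then obtain H where H: "R \<subseteq> H" "convex_set W H" and
    min: "\<And>H'. R \<subseteq> H' \<Longrightarrow> convex_set W H' \<Longrightarrow> H' \<subseteq> H \<Longrightarrow> H = H'"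
    using finite_has_minimal2[of ?F W] convex_set_self[of W] assms by auto
  have least: "H \<subseteq> H'" if "R \<subseteq> H'" "convex_set W H'" for H'
    using min[of "H \<inter> H'"] H that convex_set_Int by auto
  have "conv_hull (G \<restriction> W) R = H"
    unfolding conv_hull_def convex_in_induce
  proof (rule the_equality)
    fix H' assume H': "R \<subseteq> H' \<and> convex_set W H' \<and>
      (\<forall>H''. R \<subseteq> H'' \<and> convex_set W H'' \<and> H'' \<subseteq> H' \<longrightarrow> H'' = H')"
    then show "H' = H" using least[of H'] H by blast
  qed (use H min in blast)
  then show "R \<subseteq> conv_hull (G \<restriction> W) R" and "convex_set W (conv_hull (G \<restriction> W) R)"
    and "\<And>H. R \<subseteq> H \<Longrightarrow> convex_set W H \<Longrightarrow> conv_hull (G \<restriction> W) R \<subseteq> H"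
    using H least by auto
qed

subsection \<open>One step of the decomposition\<close>

definition rest :: "'a set \<Rightarrow> 'a set \<Rightarrow> 'a set" where
  "rest W H = (W - H) \<union> {x \<in> W. \<exists>y \<in> W - H. y \<rightarrow> x}"

text \<open>The search assigns decreasing numbers, so a larger \<open>\<alpha>\<close> means
  numbered earlier.\<close>

definition up_nbh :: "('a \<Rightarrow> nat) \<Rightarrow> 'a set \<Rightarrow> 'a \<Rightarrow> 'a set" where
  "up_nbh \<alpha> W v = {y \<in> W. v \<rightarrow> y \<and> \<alpha> v < \<alpha> y}"

text \<open>Only splits with \<open>v \<in> S\<close> matter: a vertex inside one side has no
  neighbour on the other.\<close>

definition up_unsplit :: "('a \<Rightarrow> nat) \<Rightarrow> 'a set \<Rightarrow> 'a \<Rightarrow> bool" where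
  "up_unsplit \<alpha> W v \<longleftrightarrow>
     (\<forall>S A B. clique_split W S A B \<and> v \<in> S \<longrightarrow> up_nbh \<alpha> W v \<inter> A = {} \<or> up_nbh \<alpha> W v \<inter> B = {})"

lemma closed_set_nbh_induce: "closed_set_nbh (G \<restriction> W) (W - H) = rest W H"
  unfolding closed_set_nbh_def set_nbh_def nbh_def rest_def dominates_induce by auto

lemma clique_split_restrict:
  "clique_split W S A B \<Longrightarrow> M \<subseteq> W \<Longrightarrow> clique_split M (M \<inter> S) (M \<inter> A) (M \<inter> B)"
  unfolding clique_split_def clique_def by (elim conjE, intro conjI; auto)

text \<open>An unsplittable set meeting a component of \<open>W - H\<close> cannot extend beyond
  that component and its attachment, and both survive in \<open>rest W H\<close>. Hence only atoms
  inside \<open>H\<close> can be lost.\<close>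

lemma unsplittable_subset_rest:
  assumes "convex_set W H" and "unsplittable A" and "A \<subseteq> W" and "\<not> A \<subseteq> H"
  shows "A \<subseteq> rest W H"
proof
  fix a assume a: "a \<in> A"
  obtain c where c: "c \<in> A" "c \<in> W - H" using assms by auto
  obtain K T where K: "c \<in> K" "K \<subseteq> W - H" and s: "clique_split W T K (W - K - T)"
    and T: "\<And>t. t \<in> T \<Longrightarrow> \<exists>k\<in>K. k \<rightarrow> t"
    using convex_set_component[OF assms(1) c(2)] by metis
  have "A \<inter> (W - K - T) = {}"
    using clique_split_restrict[OF s assms(3)] assms(2) c(1) K(1) unfolding unsplittable_def by blast
  then have "a \<in> K \<union> T" using a assms(3) by auto
  then show "a \<in> rest W H" using K T a assms(3) unfolding rest_def by blast
qed

text \<open>If an earlier neighbour \<open>c\<close> lay outside \<open>H\<close>, then either the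
  violating split would lift to \<open>W\<close>, or the component of \<open>c\<close> in
  \<open>W - H\<close> would itself give a violating split of \<open>W\<close>.\<close>

lemma up_unsplit_rest:
  assumes H: "convex_set W H" and v: "up_unsplit \<alpha> W v" "v \<in> W"
    and nv: "\<not> up_unsplit \<alpha> (rest W H) v"
  shows "insert v (up_nbh \<alpha> (rest W H) v) \<subseteq> H"
proof -
  let ?W = "rest W H"
  have sub: "?W \<subseteq> W" unfolding rest_def by auto
  then have up: "up_nbh \<alpha> ?W v \<subseteq> up_nbh \<alpha> W v" unfolding up_nbh_def by auto
  obtain S A B a b where s: "clique_split ?W S A B" and vS: "v \<in> S"
    and a: "a \<in> up_nbh \<alpha> ?W v" "a \<in> A" and b: "b \<in> up_nbh \<alpha> ?W v" "b \<in> B"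
    using nv unfolding up_unsplit_def by blast
  have nab: "a \<noteq> b" "\<not> a \<rightarrow> b" using s a b unfolding clique_split_def by auto
  have "c \<in> H" if c: "c \<in> up_nbh \<alpha> ?W v" for c
  proof (rule ccontr)
    assume "c \<notin> H"
    then have cW: "c \<in> W - H" using c sub unfolding up_nbh_def by auto
    obtain K T where K: "c \<in> K" "K \<subseteq> W - H"
      and t: "clique_split W T K (W - K - T)" and T: "\<And>t. t \<in> T \<Longrightarrow> \<exists>k\<in>K. k \<rightarrow> t"
      using convex_set_component[OF H cW] by metis
    have sep: "\<not> x \<rightarrow> y" "\<not> y \<rightarrow> x" if "x \<in> K" "y \<in> W" "y \<notin> K \<union> T" for x y
      using t that dominates_sym unfolding clique_split_def by blast+
    have vM: "v \<in> T \<union> K" using sep[OF K(1) v(2)] c unfolding up_nbh_def by auto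
    have M: "T \<union> K \<subseteq> ?W"
    proof
      fix x assume x: "x \<in> T \<union> K"
      have "T \<subseteq> W" using t unfolding clique_split_def by auto
      then show "x \<in> ?W" using x K(2) T[of x] unfolding rest_def by blast
    qed
    show False
    proof (cases "up_nbh \<alpha> ?W v \<subseteq> T \<union> K")
      case True
      \<comment> \<open>Restricting the split to the convex set \<open>T \<union> K\<close> and
        extending it to \<open>W\<close> keeps \<open>v\<close> in the clique and \<open>a\<close>,
        \<open>b\<close> on opposite sides.\<close>
      obtain A' B' where ext: "clique_split W ((T \<union> K) \<inter> S) A' B'"
        "(T \<union> K) \<inter> A \<subseteq> A'" "(T \<union> K) \<inter> B \<subseteq> B'"
        using clique_split_extend[OF convex_set_split_side[OF t] clique_split_restrict[OF s M]]
        by metis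
      have "a \<in> A'" "b \<in> B'" using ext True a b by auto
      then show False using v(1) ext(1) vM vS a(1) b(1) up unfolding up_unsplit_def by blast
    next
      case False
      \<comment> \<open>Here \<open>T\<close> itself separates the earlier neighbours
        \<open>c\<close> and \<open>d\<close> of \<open>v\<close>.\<close>
      then obtain d where d: "d \<in> up_nbh \<alpha> ?W v" "d \<notin> T \<union> K" by auto
      then have dW: "d \<in> W" using sub unfolding up_nbh_def by auto
      have "v \<in> T" using vM sep[of v d] d dW unfolding up_nbh_def by auto
      then have "up_nbh \<alpha> W v \<inter> K = {} \<or> up_nbh \<alpha> W v \<inter> (W - K - T) = {}"
        using v(1) t unfolding up_unsplit_def by blast
      then show False using K(1) c d dW up by blast
    qed
  qed
  moreover have "v \<in> H"
  proof (rule ccontr)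
    assume "v \<notin> H"
    then have vW: "v \<in> W - H" using v by auto
    obtain K T where K: "v \<in> K" "K \<subseteq> W - H" and t: "clique_split W T K (W - K - T)"
      using convex_set_component[OF H vW] by metis
    \<comment> \<open>The earlier neighbours are already known to lie in \<open>H\<close>; with
      \<open>v\<close> in \<open>K\<close> they fall into the clique \<open>T\<close>, although
      \<open>a\<close> and \<open>b\<close> are not adjacent.\<close>
    have "x \<in> T" if "x \<in> up_nbh \<alpha> ?W v" for x
    proof -
      have "x \<in> H" "x \<in> W" "v \<rightarrow> x"
        using that calculation sub unfolding up_nbh_def by auto
      then show ?thesis using K t unfolding clique_split_def by blast
    qed
    then have "a \<in> T" "b \<in> T" using a b by auto
    then show False using t nab unfolding clique_split_def clique_def by auto
  qed
  ultimately show ?thesis by auto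
qed

lemma closed_nbh_induce: "v \<in> W \<Longrightarrow> closed_nbh (G \<restriction> W) v = insert v {y \<in> W. v \<rightarrow> y}"
  unfolding closed_nbh_def nbh_def dominates_induce by auto

text \<open>The hypothesis \<open>up\<close> is met when \<open>v\<close> minimises an injective
  \<open>\<alpha>\<close> on \<open>W\<close>.\<close>

lemma conv_hull_closed_nbh_unsplittable:
  assumes W: "W \<subseteq> verts G" and v: "v \<in> W" "up_unsplit \<alpha> W v"
    and up: "{y \<in> W. v \<rightarrow> y} = up_nbh \<alpha> W v"
  shows "unsplittable (conv_hull (G \<restriction> W) (closed_nbh (G \<restriction> W) v))" (is "unsplittable ?H")
proof -
  let ?N = "insert v {y \<in> W. v \<rightarrow> y}"
  have N: "closed_nbh (G \<restriction> W) v = ?N" using closed_nbh_induce v by auto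
  have "?N \<subseteq> W" using v by auto
  note hull = conv_hull_least[OF W this, folded N]
  \<comment> \<open>A closed side of the extended split is convex; once it contains the
    neighbourhood it swallows the hull and leaves nothing for the other side.\<close>
  have one_side: "B = {}" if s: "clique_split ?H S A B" and e: "clique_split W S A' B'"
      and "A \<subseteq> A'" "B \<subseteq> B'" "?N \<subseteq> S \<union> A'" for S A B A' B'
  proof -
    have "?H \<subseteq> S \<union> A'"
      using hull(3)[OF _ convex_set_split_side[OF e]] that N by auto
    moreover have "B \<subseteq> ?H" using s unfolding clique_split_def by auto
    moreover have "B' \<inter> (S \<union> A') = {}" using e unfolding clique_split_def by auto
    ultimately show ?thesis using that(4) by auto
  qed
  have "A = {} \<or> B = {}" if s: "clique_split ?H S A B" for S A B
  proof -
    obtain A' B' where e: "clique_split W S A' B'" and AB: "A \<subseteq> A'" "B \<subseteq> B'"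
      using clique_split_extend[OF hull(2) s] by metis
    have We: "W = S \<union> A' \<union> B'" and sep: "\<And>x y. x \<in> A' \<Longrightarrow> y \<in> B' \<Longrightarrow> \<not> x \<rightarrow> y \<and> \<not> y \<rightarrow> x"
      using e dominates_sym unfolding clique_split_def by blast+
    have "?N \<subseteq> S \<union> A' \<or> ?N \<subseteq> S \<union> B'"
    proof (cases "v \<in> S")
      case True
      then have "up_nbh \<alpha> W v \<inter> A' = {} \<or> up_nbh \<alpha> W v \<inter> B' = {}"
        using v(2) e unfolding up_unsplit_def by blast
      then show ?thesis using We True unfolding up[symmetric] by blast
    next
      case False
      then have "v \<in> A' \<or> v \<in> B'" using v We by auto
      then show ?thesis using We sep by blast
    qed
    then show ?thesis
      using one_side[OF s e AB] one_side[OF clique_split_commute[OF s] clique_split_commute[OF e] AB(2,1)]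
      by auto
  qed
  moreover have "?H \<noteq> {}" using hull(1) N by auto
  ultimately show ?thesis unfolding unsplittable_def by auto
qed

subsection \<open>Maximum cardinality search\<close>

text \<open>All numbers in use exceed the next one to be assigned, which gives injectivity.\<close>

lemma mcs_state_invariants:
  assumes "mcs_state G i num wt"
  shows "dom num \<subseteq> verts G" and "\<forall>x j. num x = Some j \<longrightarrow> i < j" and "inj_on num (dom num)"
    and "\<forall>x \<in> verts G - dom num. wt x = card (nbh G x \<inter> dom num)"
proof -
  have "dom num \<subseteq> verts G \<and> (\<forall>x j. num x = Some j \<longrightarrow> i < j) \<and> inj_on num (dom num) \<and>
    (\<forall>x \<in> verts G - dom num. wt x = card (nbh G x \<inter> dom num))"
    using assms
  proof induct
    case init
    then show ?case by auto
  next
    case (step i num wt x)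
    have "inj_on (num(x \<mapsto> Suc i)) (dom (num(x \<mapsto> Suc i)))"
      using step unfolding inj_on_def by (auto simp: dom_def) (metis less_irrefl option.inject)+
    moreover have "(if y \<in> nbh G x - dom num then wt y + 1 else wt y)
        = card (nbh G y \<inter> dom (num(x \<mapsto> Suc i)))"
      if y: "y \<in> verts G - dom (num(x \<mapsto> Suc i))" for y
    proof (cases "x \<rightarrow> y")
      case True
      then have "nbh G y \<inter> dom (num(x \<mapsto> Suc i)) = insert x (nbh G y \<inter> dom num)"
        using dominates_sym unfolding nbh_def by auto
      moreover have "finite (nbh G y \<inter> dom num)"
        using step by (meson finite_Int finite_subset finite_verts)
      ultimately show ?thesis using True step y by (auto simp: nbh_def)
    next
      case False
      then have "nbh G y \<inter> dom (num(x \<mapsto> Suc i)) = nbh G y \<inter> dom num"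
        using dominates_sym unfolding nbh_def by auto
      then show ?thesis using False step y by (auto simp: nbh_def)
    qed
    moreover have "\<forall>y j. (num(x \<mapsto> Suc i)) y = Some j \<longrightarrow> i < j"
      using step by (auto intro: Suc_lessD)
    moreover have "dom (num(x \<mapsto> Suc i)) \<subseteq> verts G" using step by auto
    ultimately show ?case by blast
  qed
  then show "dom num \<subseteq> verts G" and "\<forall>x j. num x = Some j \<longrightarrow> i < j" and "inj_on num (dom num)"
    and "\<forall>x \<in> verts G - dom num. wt x = card (nbh G x \<inter> dom num)"
    by blast+
qed

text \<open>Invariant of one of the two sides while \<open>v\<close> is unnumbered. The second
  conjunct is what is wanted when \<open>v\<close> gets its number; the weight bound is what carries
  it through the choices in between.\<close>

definition lagging :: "'a set \<Rightarrow> 'a \<Rightarrow> ('a \<rightharpoonup> nat) \<Rightarrow> ('a \<Rightarrow> nat) \<Rightarrow> 'a set \<Rightarrow> bool" where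
  "lagging S v num wt X \<longleftrightarrow>
     (\<forall>x \<in> X - dom num. wt x \<le> card (S \<inter> dom num)) \<and> nbh G v \<inter> dom num \<inter> X = {}"

text \<open>
  Choosing a vertex \<open>x\<close> on a lagging side means that no weight exceeds the number of
  numbered vertices of the clique \<open>S\<close>. As \<open>v\<close> is adjacent to all of these, it has no
  other numbered neighbour, and hence the opposite side becomes lagging.
\<close>

lemma lagging_step:
  assumes st: "mcs_state G (Suc i) num wt" and x: "x \<in> verts G - dom num"
    and max: "\<forall>y \<in> verts G - dom num. wt y \<le> wt x"
    and s: "clique_split (verts G) S A B" and v: "v \<in> S" "v \<notin> dom num" "x \<noteq> v"
    and lag: "lagging S v num wt A"
  shows "\<exists>X\<in>{A, B}. lagging S v (num(x \<mapsto> Suc i))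
    (\<lambda>y. if y \<in> nbh G x - dom num then wt y + 1 else wt y) X"
proof -
  let ?num = "num(x \<mapsto> Suc i)" and ?wt = "\<lambda>y. if y \<in> nbh G x - dom num then wt y + 1 else wt y"
  have V: "verts G = S \<union> A \<union> B" "S \<inter> A = {}" "S \<inter> B = {}" "A \<inter> B = {}" and cS: "clique S"
    and sep: "\<And>a b. a \<in> A \<Longrightarrow> b \<in> B \<Longrightarrow> \<not> a \<rightarrow> b \<and> \<not> b \<rightarrow> a"
    using s dominates_sym unfolding clique_split_def by blast+
  have fin: "finite (dom num)"
    using mcs_state_invariants(1)[OF st] finite_subset finite_verts by blast
  consider "x \<in> S" | "x \<in> B" | "x \<in> A" using x V by auto
  then show ?thesis
  proof cases
    case 1
    \<comment> \<open>The bound grows by one and each weight by at most one, while \<open>A\<close>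
      gains no numbered vertex.\<close>
    then have "S \<inter> dom ?num = insert x (S \<inter> dom num)" by auto
    then have "card (S \<inter> dom ?num) = Suc (card (S \<inter> dom num))"
      using fin x by simp
    moreover have "nbh G v \<inter> dom ?num \<inter> A = nbh G v \<inter> dom num \<inter> A" using 1 V by auto
    moreover have "?wt y \<le> Suc (card (S \<inter> dom num))" if "y \<in> A - dom ?num" for y
    proof -
      have "wt y \<le> card (S \<inter> dom num)" using lag that unfolding lagging_def by simp
      then show ?thesis by simp
    qed
    ultimately have "lagging S v ?num ?wt A" using lag unfolding lagging_def by metis
    then show ?thesis by blast
  next
    case 2
    \<comment> \<open>\<open>x\<close> has no neighbour in \<open>A\<close>, so nothing relevant to
      \<open>A\<close> changes.\<close>
    have "S \<inter> dom ?num = S \<inter> dom num" "nbh G v \<inter> dom ?num \<inter> A = nbh G v \<inter> dom num \<inter> A"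
      using 2 V by auto
    moreover have "A \<inter> nbh G x = {}" using sep[OF _ 2] by (auto simp: nbh_def)
    ultimately have "lagging S v ?num ?wt A" using lag unfolding lagging_def by auto
    then show ?thesis by blast
  next
    case 3
    have S: "S \<inter> dom ?num = S \<inter> dom num" using 3 V by auto
    have le: "wt y \<le> card (S \<inter> dom num)" if "y \<in> verts G - dom num" for y
      using max that lag 3 x unfolding lagging_def by (meson DiffD2 DiffI le_trans)
    have "v \<rightarrow> y" if "y \<in> S \<inter> dom num" for y
    proof -
      have "v \<noteq> y" using that v(2) by blast
      then show ?thesis using cS v(1) that unfolding clique_def by blast
    qed
    then have "S \<inter> dom num \<subseteq> nbh G v \<inter> dom num" unfolding nbh_def by auto
    moreover have "card (nbh G v \<inter> dom num) \<le> card (S \<inter> dom num)"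
      using le[of v] v V mcs_state_invariants(4)[OF st] by auto
    ultimately have "nbh G v \<inter> dom num = S \<inter> dom num"
      using card_seteq[of "nbh G v \<inter> dom num" "S \<inter> dom num"] fin by auto
    then have "nbh G v \<inter> dom ?num \<inter> B = {}" using V 3 by auto
    moreover have "B \<inter> nbh G x = {}" using sep[OF 3] by (auto simp: nbh_def)
    ultimately have "lagging S v ?num ?wt B" using le V S unfolding lagging_def by auto
    then show ?thesis by blast
  qed
qed

text \<open>The lagging side may switch until \<open>v\<close> is numbered and is fixed from then
  on, since vertices numbered later receive smaller numbers.\<close>

lemma mcs_state_split:
  assumes "mcs_state G i num wt" and s: "clique_split (verts G) S A B" and v: "v \<in> S"
  shows "(v \<notin> dom num \<longrightarrow> (\<exists>X\<in>{A, B}. lagging S v num wt X)) \<and>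
    (v \<in> dom num \<longrightarrow> (\<exists>X\<in>{A, B}. \<forall>x \<in> X \<inter> nbh G v \<inter> dom num. the (num x) < the (num v)))"
  using assms(1)
proof induct
  case init
  then show ?case unfolding lagging_def by auto
next
  case (step i num wt x)
  consider "x = v" | "x \<noteq> v" "v \<notin> dom num" | "v \<in> dom num" "x \<noteq> v" by auto
  then show ?case
  proof cases
    case 1
    then obtain X where X: "X \<in> {A, B}" "lagging S v num wt X" using step by auto
    then have "X \<inter> nbh G v \<inter> dom (num(x \<mapsto> Suc i)) = {}"
      using 1 dominates_irrefl[of v] unfolding lagging_def by (auto simp: nbh_def)
    then show ?thesis using X 1 by auto
  next
    case 2
    then obtain X where X: "X \<in> {A, B}" "lagging S v num wt X" using step by auto
    then have "\<exists>X\<in>{A, B}. lagging S v (num(x \<mapsto> Suc i))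
        (\<lambda>y. if y \<in> nbh G x - dom num then wt y + 1 else wt y) X"
      using lagging_step[OF step(1,3,4) s v 2(2,1)]
        lagging_step[OF step(1,3,4) clique_split_commute[OF s] v 2(2,1)]
      by blast
    moreover have "v \<notin> dom (num(x \<mapsto> Suc i))" using 2 by auto
    ultimately show ?thesis by blast
  next
    case 3
    then obtain X where X: "X \<in> {A, B}"
      "\<forall>y \<in> X \<inter> nbh G v \<inter> dom num. the (num y) < the (num v)" using step by auto
    moreover have "Suc i < the (num v)" using mcs_state_invariants(2)[OF step(1)] 3 by auto
    ultimately have "\<forall>y \<in> X \<inter> nbh G v \<inter> dom (num(x \<mapsto> Suc i)).
        the ((num(x \<mapsto> Suc i)) y) < the ((num(x \<mapsto> Suc i)) v)"
      using 3 by auto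
    moreover have "v \<in> dom (num(x \<mapsto> Suc i))" using 3 by auto
    ultimately show ?thesis using X(1) by blast
  qed
qed

section \<open>Transfer from search states to the completed ordering\<close>

lemma mcs_ordering_inj_on:
  assumes "mcs_ordering G \<alpha>"
  shows "inj_on \<alpha> (verts G)"
proof -
  obtain num wt where st: "mcs_state G 0 num wt" and num: "\<forall>x \<in> verts G. num x = Some (\<alpha> x)"
    using assms unfolding mcs_ordering_def by auto
  have "verts G \<subseteq> dom num" using num by auto
  then show ?thesis
    using mcs_state_invariants(3)[OF st] num unfolding inj_on_def by (metis subsetD)
qed

lemma mcs_ordering_up_unsplit:
  assumes "mcs_ordering G \<alpha>" and "v \<in> verts G"
  shows "up_unsplit \<alpha> (verts G) v"
  unfolding up_unsplit_def
proof (intro allI impI, elim conjE)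
  fix S A B assume s: "clique_split (verts G) S A B" "v \<in> S"
  obtain num wt where st: "mcs_state G 0 num wt" and num: "\<forall>x \<in> verts G. num x = Some (\<alpha> x)"
    using assms unfolding mcs_ordering_def by auto
  have "v \<in> dom num" using num assms(2) by auto
  then obtain X where X: "X \<in> {A, B}" "\<forall>x \<in> X \<inter> nbh G v \<inter> dom num. the (num x) < the (num v)"
    using mcs_state_split[OF st s] by auto
  have "\<not> \<alpha> v < \<alpha> x" if "x \<in> X" "x \<in> verts G" "v \<rightarrow> x" for x
  proof -
    have "x \<in> X \<inter> nbh G v \<inter> dom num" using that num by (auto simp: nbh_def)
    then have "the (num x) < the (num v)" using X(2) by blast
    then show ?thesis using num that(2) assms(2) by simp
  qed
  then have "up_nbh \<alpha> (verts G) v \<inter> X = {}" unfolding up_nbh_def by auto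
  then show "up_nbh \<alpha> (verts G) v \<inter> A = {} \<or> up_nbh \<alpha> (verts G) v \<inter> B = {}" using X(1) by auto
qed

subsection \<open>The loop invariant\<close>

text \<open>
  The second alternative for \<open>v\<close> says that the hull computed at \<open>v\<close>, if \<open>v\<close> is ever chosen, stays
  inside the set \<open>X\<close>, the remainder of an earlier hull.
\<close>

definition rda_inv :: "('a \<Rightarrow> nat) \<Rightarrow> 'a set set \<times> 'a set \<Rightarrow> bool" where
  "rda_inv \<alpha> = (\<lambda>(\<U>, W). W \<subseteq> verts G \<and> (\<forall>U\<in>\<U>. atom G U) \<and> (\<forall>A. atom G A \<longrightarrow> A \<in> \<U> \<or> A \<subseteq> W) \<and>
     (\<forall>v\<in>W. up_unsplit \<alpha> W v \<or>
       (\<exists>X U. convex_set W X \<and> insert v (up_nbh \<alpha> W v) \<subseteq> X \<and> X \<subseteq> U \<and> U \<in> \<U>)))"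

text \<open>\<open>v\<close> and all its neighbours in \<open>W\<close> lie in the hull, so
  \<open>v\<close> leaves the working set. This gives the strict decrease and forces an unreported
  atom that contains the hull to coincide with it.\<close>

lemma rda_inv_step:
  assumes inj: "inj_on \<alpha> (verts G)" and inv: "rda_inv \<alpha> (\<U>, W)" and ne: "W \<noteq> {}"
  shows "rda_inv \<alpha> (rda_step G \<alpha> (\<U>, W)) \<and> snd (rda_step G \<alpha> (\<U>, W)) \<subset> W"
proof -
  have W: "W \<subseteq> verts G" and U: "\<And>U. U \<in> \<U> \<Longrightarrow> atom G U"
    and atoms: "\<And>A. atom G A \<Longrightarrow> A \<in> \<U> \<or> A \<subseteq> W"
    and up: "\<And>v. v \<in> W \<Longrightarrow> up_unsplit \<alpha> W v \<or>
       (\<exists>X U. convex_set W X \<and> insert v (up_nbh \<alpha> W v) \<subseteq> X \<and> X \<subseteq> U \<and> U \<in> \<U>)"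
    using inv unfolding rda_inv_def by auto
  have finW: "finite W" using finite_subset[OF W finite_verts] .
  define v where "v = arg_min_on \<alpha> W"
  have v: "v \<in> W" and v_le: "\<And>y. y \<in> W \<Longrightarrow> \<alpha> v \<le> \<alpha> y"
    using arg_min_if_finite(1)[OF finW ne] arg_min_least[OF finW ne] unfolding v_def by auto
  have nbh_up: "{y \<in> W. v \<rightarrow> y} = up_nbh \<alpha> W v"
  proof -
    have "\<alpha> v < \<alpha> y" if "y \<in> W" "v \<rightarrow> y" for y
      using v_le[OF that(1)] inj_onD[OF inj, of v y] that v W dominates_irrefl[of v]
      by (metis le_neq_implies_less subsetD)
    then show ?thesis unfolding up_nbh_def by auto
  qed
  define H where "H = conv_hull (G \<restriction> W) (closed_nbh (G \<restriction> W) v)"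
  have N: "closed_nbh (G \<restriction> W) v = insert v {y \<in> W. v \<rightarrow> y}" using closed_nbh_induce[OF v] .
  have "closed_nbh (G \<restriction> W) v \<subseteq> W" using N v by auto
  note hull = conv_hull_least[OF W this, folded H_def]
  define W' where "W' = rest W H"
  define \<U>' where "\<U>' = (if \<forall>U \<in> \<U>. \<not> H \<subseteq> U then insert H \<U> else \<U>)"
  have step: "rda_step G \<alpha> (\<U>, W) = (\<U>', W')"
    unfolding rda_step_def \<U>'_def W'_def H_def v_def by (simp add: Let_def closed_set_nbh_induce)
  have W'W: "W' \<subseteq> W" unfolding W'_def rest_def by auto
  have vH: "v \<in> H" using hull(1) N by auto
  have vW': "v \<notin> W'"
    using hull(1) vH dominates_sym unfolding N W'_def rest_def by blast
  have HV: "H \<subseteq> verts G" using hull(2) W unfolding convex_set_def by auto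
  have atom_max: "A = B" if "atom G A" "atom G B" "A \<subseteq> B" for A B
    using that unfolding atom_iff by blast
  have H_cases: "atom G H \<or> (\<exists>U\<in>\<U>. H \<subseteq> U)"
    using up[OF v]
  proof (elim disjE exE conjE)
    \<comment> \<open>The unsplittable hull lies in some atom \<open>A\<close>. If \<open>A\<close>
      is not yet reported, it lies in \<open>W\<close>; it contains \<open>v\<close>, so it is not
      inside \<open>W'\<close> and must lie in \<open>H\<close>.\<close>
    assume "up_unsplit \<alpha> W v"
    then have "unsplittable H"
      using conv_hull_closed_nbh_unsplittable[OF W v _ nbh_up] unfolding H_def by auto
    then obtain A where A: "atom G A" "H \<subseteq> A" using unsplittable_subset_atom HV by blast
    show ?thesis
    proof (cases "A \<in> \<U>")
      case False
      then have "A \<subseteq> W" using atoms A by auto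
      moreover have "\<not> A \<subseteq> W'" using A vH vW' by auto
      ultimately have "A \<subseteq> H"
        using unsplittable_subset_rest[OF hull(2)] A(1) unfolding W'_def atom_iff by blast
      then show ?thesis using A by auto
    qed (use A in auto)
  next
    fix X U assume X: "convex_set W X" "insert v (up_nbh \<alpha> W v) \<subseteq> X" "X \<subseteq> U" "U \<in> \<U>"
    have "H \<subseteq> X" using hull(3)[OF _ X(1)] X(2) N nbh_up by auto
    then show ?thesis using X(3,4) by blast
  qed
  have H_sub: "\<exists>U\<in>\<U>'. H \<subseteq> U" unfolding \<U>'_def by auto
  have U': "atom G U" if "U \<in> \<U>'" for U
    using that H_cases U unfolding \<U>'_def by (auto split: if_splits)
  have UU': "\<U> \<subseteq> \<U>'" unfolding \<U>'_def by auto
  have "A \<in> \<U>' \<or> A \<subseteq> W'" if A: "atom G A" for A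
  proof (cases "A \<in> \<U>")
    case False
    then have AW: "A \<subseteq> W" using atoms A by auto
    show ?thesis
    proof (cases "A \<subseteq> H")
      case True
      \<comment> \<open>An atom inside \<open>H\<close> lies in the reported atom covering
        \<open>H\<close> and equals it by maximality.\<close>
      then obtain U where "U \<in> \<U>'" "A \<subseteq> U" using H_sub by blast
      then show ?thesis using atom_max[OF A U'] by auto
    next
      case False
      then show ?thesis
        using unsplittable_subset_rest[OF hull(2) _ AW] A unfolding W'_def atom_iff by auto
    qed
  qed (use UU' in auto)
  moreover have "up_unsplit \<alpha> W' w \<or>
      (\<exists>X U. convex_set W' X \<and> insert w (up_nbh \<alpha> W' w) \<subseteq> X \<and> X \<subseteq> U \<and> U \<in> \<U>')"
    if w: "w \<in> W'" for w
  proof (cases "up_unsplit \<alpha> W' w")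
    case False
    have sub: "insert w (up_nbh \<alpha> W' w) \<subseteq> W'" using w unfolding up_nbh_def by auto
    \<comment> \<open>A witness convex in \<open>W\<close> suffices, as it is cut down to
      \<open>W'\<close> below. If the property was still intact at \<open>w\<close> in
      \<open>W\<close>, the witness is \<open>H\<close>; otherwise the old one is kept.\<close>
    have "\<exists>X U. convex_set W X \<and> insert w (up_nbh \<alpha> W' w) \<subseteq> X \<and> X \<subseteq> U \<and> U \<in> \<U>'"
    proof (cases "up_unsplit \<alpha> W w")
      case True
      have "insert w (up_nbh \<alpha> W' w) \<subseteq> H"
        using up_unsplit_rest[OF hull(2) True] w W'W False unfolding W'_def by blast
      then show ?thesis using hull(2) H_sub by blast
    next
      case False
      then obtain X U where X: "convex_set W X" "insert w (up_nbh \<alpha> W w) \<subseteq> X" "X \<subseteq> U" "U \<in> \<U>"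
        using up[of w] w W'W by blast
      have "up_nbh \<alpha> W' w \<subseteq> up_nbh \<alpha> W w" using W'W unfolding up_nbh_def by auto
      then show ?thesis using X UU' by blast
    qed
    then obtain X U where X: "convex_set W X" "insert w (up_nbh \<alpha> W' w) \<subseteq> X" "X \<subseteq> U" "U \<in> \<U>'"
      by blast
    have "convex_set W' (X \<inter> W')" using convex_set_restrict[OF X(1) W'W] .
    moreover have "insert w (up_nbh \<alpha> W' w) \<subseteq> X \<inter> W'" "X \<inter> W' \<subseteq> U" using X sub by auto
    ultimately show ?thesis using X(4) by blast
  qed simp
  ultimately have "rda_inv \<alpha> (\<U>', W')"
    unfolding rda_inv_def using W W'W U' by auto
  moreover have "W' \<subset> W" using W'W v vW' by auto
  ultimately show ?thesis unfolding step by simp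
qed

end

section \<open>Termination and output of the complete run\<close>

theorem theorem3p3:
  fixes G :: "('a, 'b) pre_digraph"
    and \<alpha> :: "'a \<Rightarrow> nat"
  assumes "graph G"
    and "connected G"
    and "mcs_ordering G \<alpha>"
  shows "rda G \<alpha> = Some {A. atom G A}"
proof -
  interpret graph G by fact
  have inj: "inj_on \<alpha> (verts G)" using mcs_ordering_inj_on assms(3) .
  have ne: "verts G \<noteq> {}" using assms(2) by (simp add: connected_conv)
  \<comment> \<open>Before the first execution every atom is inside \<open>verts G\<close>, and the
    search supplies the first alternative at every vertex.\<close>
  have "rda_inv \<alpha> ({}, verts G)"
    unfolding rda_inv_def using mcs_ordering_up_unsplit[OF assms(3)] by (auto simp: atom_iff)
  then have init: "rda_inv \<alpha> (rda_step G \<alpha> ({}, verts G))" using rda_inv_step[OF inj _ ne] by blast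
  let ?b = "\<lambda>(\<U> :: 'a set set, W :: 'a set). W \<noteq> {}"
  have step: "rda_inv \<alpha> (rda_step G \<alpha> s) \<and> card (snd (rda_step G \<alpha> s)) < card (snd s)"
    if inv: "rda_inv \<alpha> s" "?b s" for s
  proof -
    obtain \<U> W where s: "s = (\<U>, W)" by force
    then have W: "W \<noteq> {}" "W \<subseteq> verts G" using inv unfolding rda_inv_def by auto
    have "rda_inv \<alpha> (rda_step G \<alpha> s)" "snd (rda_step G \<alpha> s) \<subset> W"
      using rda_inv_step[OF inj _ W(1)] inv(1) s by auto
    then show ?thesis using psubset_card_mono[OF finite_subset[OF W(2) finite_verts]] s by auto
  qed
  \<comment> \<open>The size of the working set is the termination measure.\<close>
  obtain t where t: "while_option ?b (rda_step G \<alpha>) (rda_step G \<alpha> ({}, verts G)) = Some t"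
    using measure_while_option_Some[of "rda_inv \<alpha>" ?b "rda_step G \<alpha>" "\<lambda>s. card (snd s)", OF step init]
    by auto
  have "rda_inv \<alpha> t"
    using while_option_rule[of "rda_inv \<alpha>", OF _ t init] step by blast
  moreover have "snd t = {}" using while_option_stop[OF t] by (auto split: prod.splits)
  \<comment> \<open>Non-emptiness rules out the alternative \<open>A \<subseteq> W\<close> at the
    final \<open>W = {}\<close>, so every atom has been reported.\<close>
  moreover have "A \<noteq> {}" if "atom G A" for A using that unfolding atom_iff unsplittable_def by auto
  ultimately have "fst t = {A. atom G A}" unfolding rda_inv_def by (auto split: prod.splits)
  then show ?thesis unfolding rda_def t by simp
qed

end
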